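(* For $(A,B,C,D)=(2,0,2,-2)$, the series $\tan_q(z)=\tan_q^{(2,0,2,-2)}(z)$ has the continued fraction expansion $$\tan_q(z)=\cfrac{z}{[1]_qq^{-0}-\cfrac{z^2}{[3]_qq^{-0}-\cfrac{z^2}{[5]_qq^{-2}-\cfrac{z^2}{[7]_qq^{-2}-\cfrac{z^2}{\ddots}}}}}$$ where the negative powers of $q$ go like $0,0,2,2,4,4,6,6,8,8,\dots$, i.e. the $k$-th partial denominator ($k\ge1$) is $[2k-1]_q\,q^{-2\lfloor (k-1)/2\rfloor}$.
   Context: Let $0<q<1$, $[n]_q=\frac{1-q^n}{1-q}$, $[n]_q!=[1]_q[2]_q\cdots[n]_q$, $[0]_q!=1$. For a vector of exponents $(A,B,C,D)$ define the power series in $z$ $$\sin_q(z)=\sum_{n\ge0}\frac{(-1)^nz^{2n+1}}{[2n+1]_q!}q^{An^2+Bn},\qquad \cos_q(z)=\sum_{n\ge0}\frac{(-1)^nz^{2n}}{[2n]_q!}q^{Cn^2+Dn},$$ and $\tan_q^{(A,B,C,D)}(z)=\sin_q(z)/\cos_q(z)$. The continued fraction is understood as an identity of formal power series in $z$: the finite truncations (convergents), which are rational functions of $z$ expanded at $z=0$, converge coefficientwise to $\tan_q(z)$. *)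

theory Defs
  imports Complex_Main "HOL-Computational_Algebra.Formal_Power_Series"
begin

unbundle fps_syntax

definition qint :: "real \<Rightarrow> nat \<Rightarrow> real" where
  "qint q n = (1 - q ^ n) / (1 - q)"

definition qfact :: "real \<Rightarrow> nat \<Rightarrow> real" where
  "qfact q n = (\<Prod>i=1..n. qint q i)"

text \<open>The exponents may be negative, hence the integer power.
  In \<open>sin_q\<close> and \<open>cos_q\<close> the summation index is \<open>m div 2\<close>, where \<open>m\<close> is the power of \<open>z\<close>.\<close>

definition sin_q :: "real \<Rightarrow> int \<Rightarrow> int \<Rightarrow> real fps" where
  "sin_q q A B = Abs_fps (\<lambda>m. if odd m
     then let n = m div 2 in
       (-1) ^ n / qfact q (2 * n + 1) * q powi (A * (int n)\<^sup>2 + B * int n)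
     else 0)"

definition cos_q :: "real \<Rightarrow> int \<Rightarrow> int \<Rightarrow> real fps" where
  "cos_q q C D = Abs_fps (\<lambda>m. if even m
     then let n = m div 2 in
       (-1) ^ n / qfact q (2 * n) * q powi (C * (int n)\<^sup>2 + D * int n)
     else 0)"

lemma cos_q_nth_0 [simp]: "cos_q q C D $ 0 = 1"
  by (simp add: cos_q_def qfact_def)

text \<open>By \<open>cos_q_nth_0\<close> the divisor is invertible.\<close>

definition tan_q :: "real \<Rightarrow> int \<Rightarrow> int \<Rightarrow> int \<Rightarrow> int \<Rightarrow> real fps" where
  "tan_q q A B C D = sin_q q A B / cos_q q C D"

text \<open>\<open>cfrac_trunc a b k m\<close> consists of the levels \<open>k, \<dots>, k + m - 1\<close> of the continued
  fraction \<open>a k / (b k - a (k+1) / (b (k+1) - \<dots>))\<close>, with minus signs throughout.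
  The division of power series gives the expansion at \<open>z = 0\<close> of the rational function so
  written because all denominators are invertible; see \<open>cfrac_trunc_denom_nth_0\<close>.\<close>

primrec cfrac_trunc ::
    "(nat \<Rightarrow> real fps) \<Rightarrow> (nat \<Rightarrow> real fps) \<Rightarrow> nat \<Rightarrow> nat \<Rightarrow> real fps" where
  "cfrac_trunc a b k 0 = 0"
| "cfrac_trunc a b k (Suc m) = a k / (b k - cfrac_trunc a b (Suc k) m)"

lemma cfrac_trunc_denom_nth_0:
  assumes a: "\<And>k. k \<ge> 1 \<Longrightarrow> a k $ 0 = 0" and b: "\<And>k. k \<ge> 1 \<Longrightarrow> b k $ 0 \<noteq> 0" and "k \<ge> 1"
  shows "(b k - cfrac_trunc a b (Suc k) m) $ 0 = b k $ 0"
  using \<open>k \<ge> 1\<close>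
proof (induction m arbitrary: k)
  case 0
  then show ?case by simp
next
  case (Suc m)
  have "(b (Suc k) - cfrac_trunc a b (Suc (Suc k)) m) $ 0 = b (Suc k) $ 0"
    using Suc.IH[of "Suc k"] by simp
  moreover have "b (Suc k) $ 0 \<noteq> 0" "a (Suc k) $ 0 = 0"
    using a b by simp_all
  ultimately have "cfrac_trunc a b (Suc k) (Suc m) $ 0 = 0"
    by (simp add: fps_divide_nth_0)
  then show ?case by simp
qed

text \<open>Levels are numbered from 1. The limit is taken in the library's metric on formal power
  series: each coefficient of the convergents is eventually equal to that of \<open>f\<close>
  (\<open>tendsto_fps_iff\<close>).\<close>

definition has_cfrac_expansion ::
    "real fps \<Rightarrow> (nat \<Rightarrow> real fps) \<Rightarrow> (nat \<Rightarrow> real fps) \<Rightarrow> bool" where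
  "has_cfrac_expansion f a b \<longleftrightarrow> (\<lambda>m. cfrac_trunc a b 1 m) \<longlonglongrightarrow> f"

end

theory Submission
  imports Defs
begin

text \<open>The continued fraction encodes a three-term recurrence. Put
  \[ S_k = \sum_{n\ge0} \frac{(-1)^n z^{2n}}{[2n]_q!\,[2n+1]_q [2n+3]_q \cdots [2n+2k-1]_q}
       \, q^{e(2n+k)}, \qquad e(m) = \lfloor (m-1)^2/2 \rfloor , \]
  so that the cosine is \<open>S\<^sub>0\<close> and the sine is \<open>z S\<^sub>1\<close>. From
  $[2n+2k+1]_q = [2n]_q + q^{2n} [2k+1]_q$ one gets
  $S_k = b_{k+1} S_{k+1} - z^2 S_{k+2}$ with the partial denominators \<open>b\<close> of the theorem. The
  tails of the continued fraction are therefore $z^2 S_k / S_{k-1}$, and each level of the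
  fraction gains at least one power of \<open>z\<close> in the distance to the convergents.\<close>

lemma fps_X_dvd_iff: "fps_X dvd f \<longleftrightarrow> f $ 0 = 0" for f :: "real fps"
proof
  assume "f $ 0 = 0"
  then have "f = fps_X * fps_shift 1 f"
    by (simp add: fps_eq_iff)
  then show "fps_X dvd f" by (rule dvdI)
qed (auto simp: dvd_def)

text \<open>The recurrence says that the tails T_k = a_(k+1) S_(k+1) / S_k satisfy T_k = a_(k+1) /
  (b_(k+1) - T_(k+1)), as the convergents do with C in place of T_(k+1). The difference of two such
  quotients is a_(k+1) (T_(k+1) - C) times a power series, and a_(k+1) contributes the extra factor
  X.\<close>

lemma fps_X_power_dvd_cfrac_trunc_diff:
  fixes S :: "nat \<Rightarrow> real fps"
  assumes S: "\<And>k. S k $ 0 \<noteq> 0" and a: "\<And>k. a (Suc k) $ 0 = 0"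
    and rec: "\<And>k. S k = b (Suc k) * S (Suc k) - a (Suc (Suc k)) * S (Suc (Suc k))"
  shows "fps_X ^ Suc m dvd a (Suc k) * S (Suc k) / S k - cfrac_trunc a b (Suc k) m"
proof (induction m arbitrary: k)
  case 0
  have "(a (Suc k) * S (Suc k) / S k) $ 0 = 0"
    using S a by (simp add: fps_divide_unit)
  then show ?case
    by (simp add: fps_X_dvd_iff)
next
  case (Suc m)
  \<comment> \<open>Constant terms in the recurrence: a vanishes there and S does not, so b cannot
    vanish.\<close>
  have b: "b (Suc j) $ 0 \<noteq> 0" for j
  proof
    assume "b (Suc j) $ 0 = 0"
    then have "(b (Suc j) * S (Suc j) - a (Suc (Suc j)) * S (Suc (Suc j))) $ 0 = 0"
      using a by simp
    then show False
      unfolding rec[of j, symmetric] using S by simp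
  qed
  define C where "C = cfrac_trunc a b (Suc (Suc k)) m"
  define D where "D = b (Suc k) - C"
  have D0: "D $ 0 \<noteq> 0"
  proof -
    have "a j $ 0 = 0" "b j $ 0 \<noteq> 0" if "j \<ge> 1" for j
      using a[of "j - 1"] b[of "j - 1"] that by simp_all
    then have "D $ 0 = b (Suc k) $ 0"
      unfolding D_def C_def by (intro cfrac_trunc_denom_nth_0) simp_all
    then show ?thesis
      using b by simp
  qed
  let ?T = "a (Suc (Suc k)) * S (Suc (Suc k)) / S (Suc k)"
  have inv: "inverse (S j) * S j = 1" "inverse D * D = 1" for j
    using S D0 by (simp_all add: inverse_mult_eq_1)
  have T: "?T * S (Suc k) = a (Suc (Suc k)) * S (Suc (Suc k))"
    using S inv(1)[of "Suc k"] by (simp add: fps_divide_unit mult.assoc)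
  have num: "S (Suc k) * D - S k = S (Suc k) * (?T - C)"
    using T rec[of k] unfolding D_def by (simp add: algebra_simps)
  have "a (Suc k) * S (Suc k) / S k - cfrac_trunc a b (Suc k) (Suc m)
      = a (Suc k) * (S (Suc k) * inverse (S k) - inverse D)"
    using S D0 by (simp add: fps_divide_unit C_def[symmetric] D_def[symmetric] algebra_simps)
  \<comment> \<open>Inserting both units puts the two quotients over the common denominator
    \<open>S k * D\<close>.\<close>
  also have "S (Suc k) * inverse (S k) - inverse D
      = S (Suc k) * inverse (S k) * (inverse D * D) - inverse D * (inverse (S k) * S k)"
    by (simp only: inv mult_1_right)
  also have "\<dots> = (S (Suc k) * D - S k) * inverse (S k) * inverse D"
    by (simp add: algebra_simps)
  also have "a (Suc k) * \<dots> = (a (Suc k) * (?T - C)) * (S (Suc k) * inverse (S k) * inverse D)"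
    unfolding num by (simp only: ac_simps)
  finally have eq: "a (Suc k) * S (Suc k) / S k - cfrac_trunc a b (Suc k) (Suc m) = \<dots>" .
  have "fps_X dvd a (Suc k)"
    using a by (simp add: fps_X_dvd_iff)
  then have "fps_X * fps_X ^ Suc m dvd a (Suc k) * (?T - C)"
    using Suc.IH[of "Suc k"] unfolding C_def by (rule mult_dvd_mono)
  then show ?case
    unfolding eq power_Suc[of _ "Suc m"] by (rule dvd_mult2)
qed

lemma has_cfrac_expansion_recurrence:
  fixes S :: "nat \<Rightarrow> real fps"
  assumes "\<And>k. S k $ 0 \<noteq> 0" and "\<And>k. a (Suc k) $ 0 = 0"
    and "\<And>k. S k = b (Suc k) * S (Suc k) - a (Suc (Suc k)) * S (Suc (Suc k))"
  shows "has_cfrac_expansion (a 1 * S 1 / S 0) a b"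
  unfolding has_cfrac_expansion_def tendsto_fps_iff
proof
  fix n
  \<comment> \<open>Divisibility by X^(m+1) fixes all coefficients up to index m.\<close>
  have "cfrac_trunc a b 1 m $ n = (a 1 * S 1 / S 0) $ n" if "m \<ge> n" for m
  proof -
    obtain g where "a 1 * S 1 / S 0 - cfrac_trunc a b 1 m = fps_X ^ Suc m * g"
      using fps_X_power_dvd_cfrac_trunc_diff[of S a b m 0, OF assms] unfolding dvd_def One_nat_def by blast
    moreover have "(fps_X ^ Suc m * g) $ n = 0"
      using that by (subst fps_X_power_mult_nth) simp
    ultimately show ?thesis
      by (metis eq_iff_diff_eq_0 fps_sub_nth)
  qed
  then show "\<forall>\<^sub>F m in sequentially. cfrac_trunc a b 1 m $ n = (a 1 * S 1 / S 0) $ n"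
    unfolding eventually_sequentially by blast
qed

text \<open>This is e(m): it interleaves the cosine exponents 2n^2 - 2n at m = 2n with the sine
  exponents 2n^2 at m = 2n + 1. Truncated subtraction at m = 0 is harmless, since the factor
  \<open>m div 2\<close> is 0 there.\<close>

definition rem_exp :: "nat \<Rightarrow> nat" where
  "rem_exp m = 2 * (m div 2) * ((m - 1) div 2)"

text \<open>At m = 2n + k the increment is 2n + 2 \<open>(k div 2)\<close>: the first part yields
  the q^(2n) of the q-integer splitting, the second cancels the negative power in the partial
  denominator.\<close>

lemma rem_exp_Suc: "rem_exp (Suc m) = rem_exp m + 2 * (m div 2)"
  by (cases m) (simp_all add: rem_exp_def algebra_simps)

definition rem_coeff :: "real \<Rightarrow> nat \<Rightarrow> nat \<Rightarrow> real" where
  "rem_coeff q k n = 1 / (qfact q (2 * n) * (\<Prod>j<k. qint q (2 * n + 2 * j + 1)))"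

definition rem_series :: "real \<Rightarrow> nat \<Rightarrow> real fps" where
  "rem_series q k = Abs_fps (\<lambda>m. if even m
     then (-1) ^ (m div 2) * rem_coeff q k (m div 2) * q ^ rem_exp (m + k) else 0)"

context
  fixes q :: real
  assumes q: "0 < q" "q < 1"
begin

lemma qint_nonzero: "n > 0 \<Longrightarrow> qint q n \<noteq> 0"
  using q power_strict_decreasing[of 0 n q] by (simp add: qint_def)

lemma qfact_nonzero: "qfact q n \<noteq> 0"
  by (simp add: qfact_def qint_nonzero)

lemma qint_add: "qint q (m + n) = qint q m + q ^ m * qint q n"
  using q by (simp add: qint_def field_simps power_add)

lemma qfact_Suc: "qfact q (Suc n) = qint q (Suc n) * qfact q n"
  by (simp add: qfact_def)

lemma rem_coeff_Suc: "rem_coeff q k n = qint q (2 * n + 2 * k + 1) * rem_coeff q (Suc k) n"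
  using qint_nonzero[of "2 * n + 2 * k + 1"] by (simp add: rem_coeff_def)

text \<open>The factor [2n+1] of the product is absorbed into [2n+2]!, which leaves only [2n+2] to
  compensate.\<close>

lemma rem_coeff_shift: "rem_coeff q (Suc k) n = qint q (2 * n + 2) * rem_coeff q k (Suc n)"
proof -
  have "(\<Prod>j<Suc k. qint q (2 * n + 2 * j + 1))
      = qint q (2 * n + 1) * (\<Prod>j<k. qint q (2 * Suc n + 2 * j + 1))"
    by (subst prod.lessThan_Suc_shift) simp
  moreover have "qfact q (2 * Suc n) = qint q (2 * n + 2) * (qint q (2 * n + 1) * qfact q (2 * n))"
    using qfact_Suc[of "2 * n + 1"] qfact_Suc[of "2 * n"] by simp
  ultimately show ?thesis
    using qint_nonzero[of "2 * n + 2"] by (simp add: rem_coeff_def del: prod.lessThan_Suc)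
qed

text \<open>Split [2n+2k+3] = [2n+2] + q^(2n+2) [2k+1] in \<open>rem_coeff_Suc\<close>;
  \<open>rem_coeff_shift\<close> turns the [2n+2] part into the last term.\<close>

lemma rem_coeff_recurrence:
  "rem_coeff q k (Suc n) =
     qint q (2 * k + 1) * q ^ (2 * Suc n) * rem_coeff q (Suc k) (Suc n) + rem_coeff q (Suc (Suc k)) n"
  using rem_coeff_Suc[of k "Suc n"] rem_coeff_shift[of "Suc k" n]
    qint_add[of "2 * Suc n" "2 * k + 1"]
  by (simp add: algebra_simps)

lemma rem_series_recurrence:
  "rem_series q k = fps_const (qint q (2 * k + 1) * q powi (- 2 * int (k div 2))) * rem_series q (Suc k)
     - fps_X\<^sup>2 * rem_series q (Suc (Suc k))"
proof (rule fps_ext)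
  fix m
  let ?\<beta> = "q powi (- 2 * int (k div 2))"
  have exps: "?\<beta> * q ^ rem_exp (Suc (2 * n + k)) = q ^ (2 * n) * q ^ rem_exp (2 * n + k)" for n
  proof -
    have "rem_exp (Suc (2 * n + k)) = rem_exp (2 * n + k) + 2 * n + 2 * (k div 2)"
      by (simp add: rem_exp_Suc)
    moreover have "?\<beta> * q ^ (2 * (k div 2)) = 1"
      using q power_int_minus[of q "int (2 * (k div 2))"] by (simp only: power_int_of_nat) simp
    ultimately show ?thesis
      by (simp add: power_add)
  qed
  show "rem_series q k $ m = (fps_const (qint q (2 * k + 1) * ?\<beta>) * rem_series q (Suc k)
     - fps_X\<^sup>2 * rem_series q (Suc (Suc k))) $ m"
  proof (cases "even m")
    case False
    then show ?thesis
      by (auto simp: rem_series_def fps_X_power_mult_nth)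
  next
    case True
    then obtain n where m: "m = 2 * n" by blast
    show ?thesis
    proof (cases n)
      case 0
      then show ?thesis
        using m exps[of 0] rem_coeff_Suc[of k 0]
        by (simp add: rem_series_def fps_X_power_mult_nth)
    next
      case (Suc n')
      \<comment> \<open>Lowering n by 1 while raising k by 2 preserves 2n + k, so the z^2 term
        carries the same power of q.\<close>
      have shift: "rem_exp (2 * n' + Suc (Suc k)) = rem_exp (2 * n + k)"
        by (simp add: Suc)
      have "(fps_const (qint q (2 * k + 1) * ?\<beta>) * rem_series q (Suc k)
          - fps_X\<^sup>2 * rem_series q (Suc (Suc k))) $ m
        = (-1) ^ n * qint q (2 * k + 1) * rem_coeff q (Suc k) n * (?\<beta> * q ^ rem_exp (Suc (2 * n + k)))
          + (-1) ^ n * rem_coeff q (Suc (Suc k)) n' * q ^ rem_exp (2 * n' + Suc (Suc k))"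
        using m Suc by (simp add: rem_series_def fps_X_power_mult_nth algebra_simps)
      also have "\<dots> = rem_series q k $ m"
        unfolding exps shift using m Suc rem_coeff_recurrence[of k n']
        by (simp add: rem_series_def algebra_simps)
      finally show ?thesis by simp
    qed
  qed
qed

lemma rem_series_nth_0_nonzero: "rem_series q k $ 0 \<noteq> 0"
  using q by (simp add: rem_series_def rem_coeff_def qfact_nonzero qint_nonzero)

lemma cos_q_eq_rem_series: "cos_q q 2 (-2) = rem_series q 0"
proof (rule fps_ext)
  fix m
  have "2 * (int n)\<^sup>2 + -2 * int n = int (rem_exp (2 * n))" for n
    by (cases n) (simp_all add: rem_exp_def algebra_simps power2_eq_square)
  then show "cos_q q 2 (-2) $ m = rem_series q 0 $ m"
    by (auto simp: cos_q_def rem_series_def rem_coeff_def power_int_of_nat elim!: evenE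
      simp del: mult_minus_left)
qed

lemma sin_q_eq_rem_series: "sin_q q 2 0 = fps_X * rem_series q 1"
proof (rule fps_ext)
  fix m
  have "2 * (int n)\<^sup>2 + 0 * int n = int (rem_exp (2 * n + 1))" for n
    by (simp add: rem_exp_def power2_eq_square)
  then show "sin_q q 2 0 $ m = (fps_X * rem_series q 1) $ m"
    by (auto simp: sin_q_def rem_series_def rem_coeff_def power_int_of_nat qfact_Suc elim!: oddE)
qed

end

theorem theorem9:
  fixes q :: real
  assumes "0 < q" and "q < 1"
  shows "has_cfrac_expansion (tan_q q 2 0 2 (-2))
           (\<lambda>k. if k = 1 then fps_X else fps_X\<^sup>2)
           (\<lambda>k. fps_const (qint q (2 * k - 1) * q powi (- 2 * \<lfloor>(real k - 1) / 2\<rfloor>)))"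
    (is "has_cfrac_expansion _ ?a ?b")
proof -
  have "has_cfrac_expansion (?a 1 * rem_series q 1 / rem_series q 0) ?a ?b"
  proof (rule has_cfrac_expansion_recurrence)
    show "rem_series q k $ 0 \<noteq> 0" for k
      using assms by (rule rem_series_nth_0_nonzero)
    show "?a (Suc k) $ 0 = 0" for k
      by simp
    have "\<lfloor>(real (Suc k) - 1) / 2\<rfloor> = int (k div 2)" for k
      using floor_divide_of_nat_eq[of k 2] by simp
    \<comment> \<open>The index \<open>Suc (Suc k)\<close> is never 1, so the numerator here is
      always X^2; the exceptional numerator X only turns S_1 into the sine.\<close>
    then show "rem_series q k = ?b (Suc k) * rem_series q (Suc k)
        - ?a (Suc (Suc k)) * rem_series q (Suc (Suc k))" for k
      using rem_series_recurrence[OF assms, of k] by simp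
  qed
  then show ?thesis
    using assms by (simp add: tan_q_def sin_q_eq_rem_series cos_q_eq_rem_series)
qed

end
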